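(* Let $G$ be a total reduction graph such that $S := S(G)$ is a numerical semigroup (so $\mathrm{Bal}(G)=1$). Then the sum $\sum_{e\in E(G)}\mathrm{Rem}(e)$ is a direct sum and $$\mathrm{Ap}(S, r(G)) = \bigoplus_{e \in E(G)} \mathrm{Rem}(e).$$
   Context: $\mathbb{N}$ = nonnegative integers; $\langle a\rangle := \{an : n\in\mathbb{N}\}$. For sets $A,B$, $A+B := \{a+b\}$; $C=A\oplus B$ means $C=A+B$ with unique representations (a sum of finitely many sets is direct if every element has a unique representation). For a (possibly infinite) family of sets containing $0$, $\sum_i A_i$ is the set of all finite sums of elements from distinct members. A reduction graph $G$ consists of a multicollection $V(G)$ of nodes (nonempty subsets of $\mathbb{N}$ containing $0$) and a finite set $E(G)$ of hyperedges; each edge $e$ has input nodes $B_j$ and output nodes $A_i$ and a finite remainder set $\mathrm{Rem}(e)$ with $\sum_i A_i + \sum_j B_j = (\sum_i A_i)\oplus\mathrm{Rem}(e)$, weight $w(e):=|\mathrm{Rem}(e)|$. Viewing edges as arrows from inputs to outputs, $G$ is acyclic; exactly one node (the root) is an input of no edge and equals $\langle r(G)\rangle$ for a positive integer $r(G)$; every other node is an input of exactly one edge. $S(G) := \sum_{X\in V(G)}X$. $\mathrm{Bal}(G) := r(G)/\prod_{e} w(e)$, and $G$ is total if $\mathrm{Bal}(G) = \gcd(S(G))$. A numerical semigroup is a submonoid $S$ of $\mathbb{N}$ with finite complement; for $a \in S\setminus\{0\}$, the Apéry set is $\mathrm{Ap}(S,a) := \{s\in S : s-a\notin S\}$. *)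

theory Defs
  imports Complex_Main "HOL-Library.Set_Algebras" "HOL-Library.FuncSet"
begin

text \<open>
  Sets are added with the operations of HOL-Library.Set_Algebras: \<open>A + B\<close> is the Minkowski sum, and
  \<open>\<Sum>i\<in>I. F i\<close> over a finite \<open>I\<close> is the iterated Minkowski sum.  The next definition is the
  sum of a possibly infinite family of sets containing 0.
\<close>

definition family_sum :: "'i set \<Rightarrow> ('i \<Rightarrow> nat set) \<Rightarrow> nat set" where
  "family_sum I F = {(\<Sum>i\<in>J. f i) | J f. finite J \<and> J \<subseteq> I \<and> (\<forall>i\<in>J. f i \<in> F i)}"

definition direct2 :: "nat set \<Rightarrow> nat set \<Rightarrow> bool" where
  "direct2 A B \<longleftrightarrow> inj_on (\<lambda>(a, b). a + b) (A \<times> B)"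

definition direct_family :: "'i set \<Rightarrow> ('i \<Rightarrow> nat set) \<Rightarrow> bool" where
  "direct_family I F \<longleftrightarrow> inj_on (\<lambda>f. \<Sum>i\<in>I. f i) (PiE I F)"

definition multiples :: "nat \<Rightarrow> nat set" where
  "multiples a = range (\<lambda>n. a * n)"

text \<open>
  Nodes and edges are abstract names, so that the nodes form a multicollection: distinct names may
  carry the same set \<open>node_set G v\<close>.
\<close>

record ('v, 'e) hypergraph =
  nodes :: "'v set"
  edges :: "'e set"
  node_set :: "'v \<Rightarrow> nat set"
  inputs :: "'e \<Rightarrow> 'v set"
  outputs :: "'e \<Rightarrow> 'v set"
  Rem :: "'e \<Rightarrow> nat set"

definition arrows :: "('v, 'e) hypergraph \<Rightarrow> ('v \<times> 'v) set" where
  "arrows G = {(u, v). \<exists>e\<in>edges G. u \<in> inputs G e \<and> v \<in> outputs G e}"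

definition is_root :: "('v, 'e) hypergraph \<Rightarrow> 'v \<Rightarrow> bool" where
  "is_root G v \<longleftrightarrow> v \<in> nodes G \<and> (\<forall>e\<in>edges G. v \<notin> inputs G e)"

definition reduction_edge :: "('v, 'e) hypergraph \<Rightarrow> 'e \<Rightarrow> bool" where
  "reduction_edge G e \<longleftrightarrow>
     inputs G e \<subseteq> nodes G \<and> outputs G e \<subseteq> nodes G \<and> finite (Rem G e) \<and>
     family_sum (outputs G e) (node_set G) + family_sum (inputs G e) (node_set G)
       = family_sum (outputs G e) (node_set G) + Rem G e \<and>
     direct2 (family_sum (outputs G e) (node_set G)) (Rem G e)"

definition reduction_graph :: "('v, 'e) hypergraph \<Rightarrow> bool" where
  "reduction_graph G \<longleftrightarrow>
     (\<forall>v\<in>nodes G. 0 \<in> node_set G v) \<and>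
     finite (edges G) \<and>
     (\<forall>e\<in>edges G. reduction_edge G e) \<and>
     acyclic (arrows G) \<and>
     (\<exists>!v. is_root G v) \<and>
     (\<forall>v. is_root G v \<longrightarrow> (\<exists>r>0. node_set G v = multiples r)) \<and>
     (\<forall>v\<in>nodes G. \<not> is_root G v \<longrightarrow> (\<exists>!e. e \<in> edges G \<and> v \<in> inputs G e))"

definition root :: "('v, 'e) hypergraph \<Rightarrow> 'v" where
  "root G = (THE v. is_root G v)"

definition root_gen :: "('v, 'e) hypergraph \<Rightarrow> nat" where
  "root_gen G = (THE r. r > 0 \<and> node_set G (root G) = multiples r)"

definition node_sum :: "('v, 'e) hypergraph \<Rightarrow> nat set" where
  "node_sum G = family_sum (nodes G) (node_set G)"

definition weight :: "('v, 'e) hypergraph \<Rightarrow> 'e \<Rightarrow> nat" where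
  "weight G e = card (Rem G e)"

definition Bal :: "('v, 'e) hypergraph \<Rightarrow> rat" where
  "Bal G = of_nat (root_gen G) / (\<Prod>e\<in>edges G. of_nat (weight G e))"

definition total_graph :: "('v, 'e) hypergraph \<Rightarrow> bool" where
  "total_graph G \<longleftrightarrow> Bal G = of_nat (Gcd (node_sum G))"

definition numerical_semigroup :: "nat set \<Rightarrow> bool" where
  "numerical_semigroup S \<longleftrightarrow> 0 \<in> S \<and> (\<forall>a\<in>S. \<forall>b\<in>S. a + b \<in> S) \<and> finite (UNIV - S)"

text \<open>The difference is taken in the integers, since subtraction on \<^typ>\<open>nat\<close> truncates.\<close>

definition Apery :: "nat set \<Rightarrow> nat \<Rightarrow> nat set" where
  "Apery S a = {s \<in> S. int s - int a \<notin> int ` S}"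

end

theory Submission
  imports Defs
begin

text \<open>
  Trading the inputs of an edge for its remainder, edge by edge in topological order, turns the sum
  of all nodes into \<open>S = \<langle>r\<rangle> + T\<close> with \<open>T = \<Sum>\<^sub>e Rem(e)\<close>. As \<open>S\<close> is cofinite,
  \<open>T\<close> meets every residue class modulo \<open>r\<close>. But \<open>T\<close> is the image of a product of
  \<open>\<Prod>\<^sub>e w(e) = r\<close> elements, so this product maps bijectively onto the residue classes. Hence the
  sum is direct, and \<open>T\<close> consists of the least element of \<open>S\<close> in each class.
\<close>

section \<open>Sums of families of sets\<close>

lemma family_sum_singleton:
  assumes "0 \<in> F i"
  shows "family_sum {i} F = F i"
proof
  \<comment> \<open>The empty subfamily contributes the sum 0, which has to lie in
    \<open>F i\<close>.\<close>
  show "family_sum {i} F \<subseteq> F i"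
    using assms by (auto simp: family_sum_def subset_singleton_iff)
  show "F i \<subseteq> family_sum {i} F"
  proof
    fix x assume "x \<in> F i"
    then have "x = (\<Sum>j\<in>{i}. x) \<and> finite {i} \<and> {i} \<subseteq> {i} \<and> (\<forall>j\<in>{i}. x \<in> F j)"
      by simp
    then show "x \<in> family_sum {i} F"
      unfolding family_sum_def mem_Collect_eq by (intro exI[of _ "{i}"] exI[of _ "\<lambda>_. x"])
  qed
qed

text \<open>A selection from the union splits along \<open>I\<close> and \<open>K\<close>, and two
  selections glue to one. Disjointness is what allows the gluing: a common index could receive two
  different summands.\<close>

lemma family_sum_Un:
  assumes "I \<inter> K = {}"
  shows "family_sum (I \<union> K) F = family_sum I F + family_sum K F"
proof
  show "family_sum (I \<union> K) F \<subseteq> family_sum I F + family_sum K F"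
  proof
    fix x assume "x \<in> family_sum (I \<union> K) F"
    then obtain J f where J: "finite J" "J \<subseteq> I \<union> K" "\<forall>i\<in>J. f i \<in> F i" and x: "x = sum f J"
      unfolding family_sum_def by blast
    have "J = (J \<inter> I) \<union> (J \<inter> K)" using J by auto
    then have "x = sum f (J \<inter> I) + sum f (J \<inter> K)"
      using x J(1) assms sum.union_disjoint[of "J \<inter> I" "J \<inter> K" f] by fastforce
    moreover have "sum f (J \<inter> I) \<in> family_sum I F" "sum f (J \<inter> K) \<in> family_sum K F"
      using J unfolding family_sum_def by blast+
    ultimately show "x \<in> family_sum I F + family_sum K F"
      by (simp add: set_plus_intro)
  qed
  show "family_sum I F + family_sum K F \<subseteq> family_sum (I \<union> K) F"
  proof
    fix x assume "x \<in> family_sum I F + family_sum K F"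
    then obtain J f J' f'
      where J: "finite J" "J \<subseteq> I" "\<forall>i\<in>J. f i \<in> F i"
        and J': "finite J'" "J' \<subseteq> K" "\<forall>i\<in>J'. f' i \<in> F i"
        and x: "x = sum f J + sum f' J'"
      unfolding family_sum_def set_plus_def by blast
    define h where "h i = (if i \<in> J then f i else f' i)" for i
    have dis: "J \<inter> J' = {}" using J J' assms by auto
    have "sum h (J \<union> J') = sum h J + sum h J'"
      using J J' dis by (simp add: sum.union_disjoint)
    also have "sum h J = sum f J" by (simp add: h_def)
    also have "sum h J' = sum f' J'"
      using dis by (intro sum.cong) (auto simp: h_def)
    finally have "x = sum h (J \<union> J')" using x by simp
    moreover have "finite (J \<union> J')" "J \<union> J' \<subseteq> I \<union> K" "\<forall>i\<in>J \<union> J'. h i \<in> F i"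
      using J J' by (auto simp: h_def)
    ultimately show "x \<in> family_sum (I \<union> K) F"
      unfolding family_sum_def by blast
  qed
qed

section \<open>The root and the elimination of edges\<close>

lemma multiples_inject:
  assumes "multiples a = multiples b"
  shows "a = b"
proof (rule dvd_antisym)
  have "x \<in> multiples x" for x
    unfolding multiples_def by (metis mult.right_neutral rangeI)
  then have "a \<in> multiples b" "b \<in> multiples a" using assms by auto
  then show "a dvd b" "b dvd a" by (auto simp: multiples_def)
qed

lemma reduction_graph_root:
  assumes "reduction_graph G"
  shows "is_root G (root G)" "root_gen G > 0" "node_set G (root G) = multiples (root_gen G)"
proof -
  have ex1: "\<exists>!v. is_root G v" using assms by (simp add: reduction_graph_def)
  show "is_root G (root G)" unfolding root_def by (rule theI'[OF ex1])
  then obtain r where "r > 0" "node_set G (root G) = multiples r"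
    using assms unfolding reduction_graph_def by blast
  \<comment> \<open>\<open>root_gen\<close> is a definite description, so uniqueness of the
    generator is needed before anything can be said about it.\<close>
  then have "\<exists>!r. r > 0 \<and> node_set G (root G) = multiples r"
    using multiples_inject by auto
  from theI'[OF this] show "root_gen G > 0" "node_set G (root G) = multiples (root_gen G)"
    by (simp_all add: root_gen_def)
qed

text \<open>Order edges by "an output of \<open>f\<close> is an input of \<open>e\<close>". A cycle
  of edges would give a cycle of nodes, so on the finite set \<open>F\<close> this relation is
  well-founded, and a minimal edge is a source. It supplies the next edge to eliminate.\<close>

lemma exists_source_edge:
  assumes "acyclic (arrows G)" "finite F" "F \<subseteq> edges G" "F \<noteq> {}"
  shows "\<exists>e\<in>F. \<forall>f\<in>F. outputs G f \<inter> inputs G e = {}"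
proof -
  define R where "R = {(f, e). f \<in> F \<and> e \<in> F \<and> outputs G f \<inter> inputs G e \<noteq> {}}"
  \<comment> \<open>The witness must not depend on \<open>u\<close>: this is what closes up a cycle of edges to a cycle of nodes.\<close>
  have path: "\<exists>v\<in>inputs G e. \<forall>u\<in>inputs G f. (u, v) \<in> (arrows G)\<^sup>+" if "(f, e) \<in> R\<^sup>+" for f e
    using that
  proof (induction rule: trancl_induct)
    case (base e)
    then obtain v where "v \<in> outputs G f" "v \<in> inputs G e" "f \<in> edges G"
      using assms(3) by (auto simp: R_def)
    then show ?case by (intro bexI[of _ v]) (auto simp: arrows_def)
  next
    case (step e g)
    then obtain v where v: "v \<in> inputs G e" "\<forall>u\<in>inputs G f. (u, v) \<in> (arrows G)\<^sup>+" by blast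
    obtain w where w: "w \<in> outputs G e" "w \<in> inputs G g" "e \<in> edges G"
      using step(2) assms(3) by (auto simp: R_def)
    have "(v, w) \<in> arrows G" using v w by (auto simp: arrows_def)
    then show ?case using v w by (meson trancl.trancl_into_trancl)
  qed
  have "acyclic R"
    unfolding acyclic_def using path assms(1) by (meson acyclic_def)
  moreover have "finite R"
    by (rule finite_subset[of _ "F \<times> F"]) (auto simp: R_def assms(2))
  ultimately have "wf R" by (simp add: finite_acyclic_wf)
  then obtain e where "e \<in> F" "\<And>f. (f, e) \<in> R \<Longrightarrow> f \<notin> F"
    using assms(4) by (meson ex_in_conv wfE_min)
  then show ?thesis unfolding R_def by blast
qed

text \<open>The last hypothesis says that \<open>F\<close> is closed under passing to outputs, which
  makes the claim inductive: deleting a source edge preserves closure, because no edge of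
  \<open>F\<close> feeds into its inputs.\<close>

lemma reduce_edges:
  assumes G: "reduction_graph G" and "F \<subseteq> edges G"
    and "\<And>e. e \<in> F \<Longrightarrow> outputs G e \<subseteq> insert (root G) (\<Union>e\<in>F. inputs G e)"
  shows "family_sum (insert (root G) (\<Union>e\<in>F. inputs G e)) (node_set G)
           = node_set G (root G) + (\<Sum>e\<in>F. Rem G e)"
proof -
  have "finite F" using assms(2) G by (auto simp: reduction_graph_def intro: finite_subset)
  then show ?thesis using assms(2,3)
  proof (induction F rule: finite_psubset_induct)
    case (psubset F)
    have root: "root G \<in> nodes G" "\<And>e. e \<in> edges G \<Longrightarrow> root G \<notin> inputs G e"
      using reduction_graph_root(1)[OF G] by (auto simp: is_root_def)
    have zero: "0 \<in> node_set G (root G)"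
      using root(1) G by (simp add: reduction_graph_def)
    show ?case
    proof (cases "F = {}")
      case True
      then show ?thesis using zero by (simp add: family_sum_singleton)
    next
      case False
      have "acyclic (arrows G)" using G by (simp add: reduction_graph_def)
      from exists_source_edge[OF this psubset.hyps psubset.prems(1) False]
      obtain e where e: "e \<in> F" and src: "\<And>f. f \<in> F \<Longrightarrow> outputs G f \<inter> inputs G e = {}" by blast
      define N where "N = insert (root G) (\<Union>f\<in>F - {e}. inputs G f)"
      have eG: "e \<in> edges G" using e psubset.prems by blast
      then have red: "reduction_edge G e" using G by (simp add: reduction_graph_def)
      have split: "insert (root G) (\<Union>f\<in>F. inputs G f) = N \<union> inputs G e"
        using e by (auto simp: N_def)
      have unique: "f = e" if "f \<in> F" "v \<in> inputs G f" "v \<in> inputs G e" for f v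
      proof -
        have "f \<in> edges G" using that(1) psubset.prems(1) by blast
        moreover have "v \<in> nodes G" using red that(3) by (auto simp: reduction_edge_def)
        moreover have "\<not> is_root G v" using that(3) eG by (auto simp: is_root_def)
        ultimately show ?thesis using G that eG unfolding reduction_graph_def by blast
      qed
      \<comment> \<open>Since a non-root node is an input of one edge only, deleting
        \<open>e\<close> removes all of its inputs from the sum at once.\<close>
      have dis: "N \<inter> inputs G e = {}"
        using unique root(2)[OF eG] by (auto simp: N_def)
      \<comment> \<open>Used twice: for the edges of \<open>F - {e}\<close> it is the closure
        required by the induction hypothesis, and for \<open>e\<close> itself it permits the
        exchange below.\<close>
      have out: "outputs G f \<subseteq> N" if "f \<in> F" for f
        using psubset.prems(2)[OF that] src[OF that] split by blast
      have "family_sum N (node_set G) = node_set G (root G) + (\<Sum>f\<in>F - {e}. Rem G f)"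
        unfolding N_def
        by (rule psubset.IH) (use e psubset.prems(1) out N_def in auto)
      moreover have "family_sum N (node_set G) + family_sum (inputs G e) (node_set G)
                       = family_sum N (node_set G) + Rem G e"
      proof -
        \<comment> \<open>The edge identity applies only in the presence of the outputs of
          \<open>e\<close>. These lie in \<open>N\<close>, and the remaining nodes of
          \<open>N\<close> are carried along as a common summand.\<close>
        have "family_sum N (node_set G) = family_sum ((N - outputs G e) \<union> outputs G e) (node_set G)"
          using out[OF e] by (simp add: Un_absorb2)
        also have "\<dots> = family_sum (N - outputs G e) (node_set G)
                       + family_sum (outputs G e) (node_set G)"
          by (rule family_sum_Un) auto
        finally show ?thesis using red by (simp add: reduction_edge_def add.assoc)
      qed
      moreover have "(\<Sum>f\<in>F. Rem G f) = Rem G e + (\<Sum>f\<in>F - {e}. Rem G f)"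
        using psubset.hyps e by (rule sum.remove)
      ultimately show ?thesis
        unfolding split family_sum_Un[OF dis] by (simp add: ac_simps)
    qed
  qed
qed

lemma node_sum_eq:
  assumes G: "reduction_graph G"
  shows "node_sum G = multiples (root_gen G) + (\<Sum>e\<in>edges G. Rem G e)"
proof -
  have ex1: "\<exists>!v. is_root G v" using G by (simp add: reduction_graph_def)
  note root = reduction_graph_root[OF G]
  have sub: "inputs G e \<subseteq> nodes G" "outputs G e \<subseteq> nodes G" if "e \<in> edges G" for e
    using G that by (auto simp: reduction_graph_def reduction_edge_def)
  \<comment> \<open>Every node is the root or an input of some edge, so the set of all edges meets
    the closure condition of \<open>reduce_edges\<close>.\<close>
  have "nodes G \<subseteq> insert (root G) (\<Union>e\<in>edges G. inputs G e)"
    using ex1 root(1) by (auto simp: is_root_def)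
  moreover have "insert (root G) (\<Union>e\<in>edges G. inputs G e) \<subseteq> nodes G"
    using sub root(1) by (auto simp: is_root_def)
  ultimately have nodes: "insert (root G) (\<Union>e\<in>edges G. inputs G e) = nodes G" by blast
  show ?thesis
    using reduce_edges[OF G order_refl] sub
    by (simp add: nodes root(3) node_sum_def)
qed

section \<open>Numerical semigroups and the balance\<close>

lemma numerical_semigroup_eventually:
  assumes "numerical_semigroup S"
  obtains M where "\<And>n. n \<ge> M \<Longrightarrow> n \<in> S"
proof -
  have "finite (UNIV - S)" using assms by (simp add: numerical_semigroup_def)
  then obtain M where "\<forall>n\<in>UNIV - S. n < M" using finite_nat_set_iff_bounded by blast
  then show ?thesis using that[of M] by (meson DiffI UNIV_I not_le)
qed

lemma Gcd_numerical_semigroup: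
  assumes "numerical_semigroup S"
  shows "Gcd S = 1"
proof -
  obtain M where "\<And>n. n \<ge> M \<Longrightarrow> n \<in> S" using numerical_semigroup_eventually[OF assms] by blast
  \<comment> \<open>A common divisor of two consecutive elements divides 1.\<close>
  then have "M \<in> S" "Suc M \<in> S" by auto
  then have "Gcd S dvd M" "Gcd S dvd Suc M" by auto
  then have "Gcd S dvd Suc M - M" by (rule dvd_diff_nat[rotated])
  then show ?thesis by simp
qed

lemma total_root_gen:
  assumes "total_graph G" "numerical_semigroup (node_sum G)"
  shows "root_gen G = (\<Prod>e\<in>edges G. card (Rem G e))"
proof -
  have "of_nat (root_gen G) / of_nat (\<Prod>e\<in>edges G. card (Rem G e)) = (1::rat)"
    using assms by (simp add: total_graph_def Bal_def weight_def Gcd_numerical_semigroup)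
  \<comment> \<open>Division by 0 yields 0, so a quotient equal to 1 also rules out a zero
    product.\<close>
  then have "of_nat (root_gen G) = (of_nat (\<Prod>e\<in>edges G. card (Rem G e)) :: rat)"
    by (simp only: divide_eq_1_iff)
  then show ?thesis by (simp only: of_nat_eq_iff)
qed

section \<open>Residue classes and the Apery set\<close>

lemma sum_sets_eq_image_PiE:
  fixes F :: "'i \<Rightarrow> nat set"
  assumes "finite I"
  shows "(\<Sum>i\<in>I. F i) = (\<lambda>f. \<Sum>i\<in>I. f i) ` (PiE I F)"
proof
  show "(\<Sum>i\<in>I. F i) \<subseteq> (\<lambda>f. \<Sum>i\<in>I. f i) ` (PiE I F)"
  proof
    fix x assume "x \<in> (\<Sum>i\<in>I. F i)"
    then obtain s where "x = sum s I" "\<forall>i\<in>I. s i \<in> F i"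
      using assms by (auto simp: set_sum_alt)
    \<comment> \<open>\<open>restrict\<close> makes the selection extensional without changing its
      sum over \<open>I\<close>.\<close>
    then show "x \<in> (\<lambda>f. \<Sum>i\<in>I. f i) ` (PiE I F)"
      by (intro image_eqI[of _ _ "restrict s I"]) auto
  qed
  show "(\<lambda>f. \<Sum>i\<in>I. f i) ` (PiE I F) \<subseteq> (\<Sum>i\<in>I. F i)"
    using assms by (auto simp: set_sum_alt)
qed

text \<open>An element \<open>r * n + t\<close> with \<open>n > 0\<close> stays in \<open>S\<close>
  after subtracting \<open>r\<close>, so only \<open>n = 0\<close> survives. Conversely, if
  \<open>t - r\<close> were in \<open>S\<close>, its component in \<open>T\<close> would be
  congruent to \<open>t\<close>, hence equal to \<open>t\<close>, which is too large.\<close>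

lemma Apery_eq:
  assumes S: "S = multiples r + T" and r: "r > 0" and inj: "inj_on (\<lambda>t. t mod r) T"
  shows "Apery S r = T"
proof
  show "Apery S r \<subseteq> T"
  proof
    fix s assume "s \<in> Apery S r"
    then have sS: "s \<in> S" and no: "int s - int r \<notin> int ` S" by (auto simp: Apery_def)
    then obtain n t where s: "s = r * n + t" "t \<in> T"
      unfolding S by (auto simp: multiples_def set_plus_def)
    show "s \<in> T"
    proof (cases n)
      case 0
      then show ?thesis using s by simp
    next
      case (Suc m)
      then have "int s - int r = int (r * m + t)" using s by (simp add: algebra_simps)
      moreover have "r * m + t \<in> S"
        unfolding S using s by (auto simp: multiples_def intro: set_plus_intro)
      ultimately show ?thesis using no by blast
    qed
  qed
  show "T \<subseteq> Apery S r"
  proof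
    fix t assume t: "t \<in> T"
    have "0 \<in> multiples r" by (auto simp: multiples_def)
    then have "t \<in> S" unfolding S using set_plus_intro[OF _ t, of 0] by simp
    moreover have False if "int t - int r \<in> int ` S"
    proof -
      from that obtain x where "x \<in> S" and x: "int t - int r = int x" by blast
      then obtain n u where u: "u \<in> T" and n: "x = r * n + u"
        unfolding S by (auto simp: multiples_def set_plus_def)
      have "t = r + x" using x by linarith
      \<comment> \<open>The subtracted \<open>r\<close> turns \<open>n\<close> into
        \<open>Suc n\<close>, so the multiple of \<open>r\<close> is positive even for
        \<open>n = 0\<close>.\<close>
      then have eq: "t = u + r * Suc n" using n by simp
      then have "t mod r = u mod r" by (simp only: mod_mult_self2)
      then have "t = u" using inj t u by (simp add: inj_on_def)
      then show False using eq r by simp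
    qed
    ultimately show "t \<in> Apery S r" by (auto simp: Apery_def)
  qed
qed

theorem theorem3p1:
  fixes G :: "('v, 'e) hypergraph"
  assumes "reduction_graph G"
    and "total_graph G"
    and "numerical_semigroup (node_sum G)"
  shows "direct_family (edges G) (Rem G) \<and>
         Apery (node_sum G) (root_gen G) = (\<Sum>e\<in>edges G. Rem G e)"
proof -
  define r where "r = root_gen G"
  define P where "P = PiE (edges G) (Rem G)"
  define T where "T = (\<Sum>e\<in>edges G. Rem G e)"
  have r: "r > 0" using reduction_graph_root(2)[OF assms(1)] by (simp add: r_def)
  have S: "node_sum G = multiples r + T"
    using node_sum_eq[OF assms(1)] by (simp add: r_def T_def)
  have fin: "finite (edges G)" "\<And>e. e \<in> edges G \<Longrightarrow> finite (Rem G e)"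
    using assms(1) by (auto simp: reduction_graph_def reduction_edge_def)
  have P: "finite P" "card P = r"
    using fin total_root_gen[OF assms(2,3)] by (auto simp: P_def r_def card_PiE intro: finite_PiE)
  have T: "T = (\<lambda>f. \<Sum>e\<in>edges G. f e) ` P"
    unfolding T_def P_def by (rule sum_sets_eq_image_PiE[OF fin(1)])
  obtain M where M: "\<And>n. n \<ge> M \<Longrightarrow> n \<in> node_sum G"
    using numerical_semigroup_eventually[OF assms(3)] by blast
  have "{..<r} \<subseteq> (\<lambda>t. t mod r) ` T"
  proof
    fix k assume "k \<in> {..<r}"
    then have k: "k < r" by simp
    \<comment> \<open>The offset \<open>r * M\<close> leaves the residue \<open>k\<close> unchanged
      and pushes it past all gaps of the semigroup.\<close>
    have "M \<le> r * M" using r by (cases r) auto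
    then have "r * M + k \<in> node_sum G" by (intro M) (rule trans_le_add1)
    then obtain n t where t: "t \<in> T" "r * M + k = r * n + t"
      unfolding S by (auto simp: multiples_def set_plus_def)
    then have "t mod r = (r * M + k) mod r" by simp
    then have "k = t mod r" using k by simp
    then show "k \<in> (\<lambda>t. t mod r) ` T" using t by blast
  qed
  then have "card P \<le> card ((\<lambda>t. t mod r) ` T)"
    using card_mono[of "(\<lambda>t. t mod r) ` T" "{..<r}"] P T by simp
  \<comment> \<open>Reaching all \<open>r\<close> classes bounds the image below by
    \<open>card P\<close>, and an image never exceeds its domain. Equality on a finite set forces
    injectivity.\<close>
  then have "card ((\<lambda>f. (\<Sum>e\<in>edges G. f e) mod r) ` P) = card P"
    unfolding T image_image by (intro le_antisym card_image_le P(1))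
  then have inj: "inj_on (\<lambda>f. (\<Sum>e\<in>edges G. f e) mod r) P"
    by (rule eq_card_imp_inj_on[OF P(1)])
  \<comment> \<open>Equal sums have equal residues, so injectivity modulo \<open>r\<close> on
    selections gives directness. It also separates the elements of \<open>T\<close> modulo
    \<open>r\<close>, as \<open>Apery_eq\<close> requires.\<close>
  have "direct_family (edges G) (Rem G)"
    using inj by (auto simp: direct_family_def P_def inj_on_def)
  moreover have "inj_on (\<lambda>t. t mod r) T"
    using inj by (auto simp: T inj_on_def)
  then have "Apery (node_sum G) r = T" by (rule Apery_eq[OF S r])
  ultimately show ?thesis by (simp add: r_def T_def)
qed

end
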